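(* Let $F(x)=f(x)+\max_{u\in Q}\{\langle Ax,u\rangle-\phi(u)\}$ on $\mathbb{R}^n$ have set of minimizers $X^*\neq\emptyset$ and minimum value $F^*$, and let $F_\gamma$ be its Nesterov smoothing with parameter $\gamma>0$ (see context). Let $x_0\in\mathbb{R}^n$ and suppose that there are $\kappa>0$ and $q\in[1,2]$ such that $F(x)-F^*\ge\frac{\kappa}{q}\|x-\bar x\|^q$ for all $x\in\mathcal{L}_F(x_0,\gamma)=\{x: F(x)\le F(x_0)+\gamma\bar D\}$. Then: (1) $$F_\gamma(x)-F_\gamma^*\ \ge\ \hat\kappa\|x-\bar x\|_1^q-\gamma\bar D\quad\forall x\in\mathcal{L}_{F_\gamma}(x_0),\qquad\text{with }\hat\kappa=\frac{\kappa}{qL_{\max}^{q/2}}.$$ (2) With $\hat X=\mathcal{L}_{F_\gamma}(x_0)\cap\{x\in\mathbb{R}^n: F_\gamma(x)-F^*\ge\gamma\bar D\}$, $$F_\gamma(x)-F_\gamma^*\ \ge\ \hat\kappa\|x-\bar x\|_1^q\quad\forall x\in\hat X,\qquad\text{with }\hat\kappa=\frac{\kappa}{2qL_{\max}^{q/2}}.$$ (3) If additionally there is $R>0$ with $\|x-\bar x\|\le R$ for all $x\in\mathcal{L}_{F_\gamma}(x_0)$, then $$F_\gamma(x)-F_\gamma^*\ \ge\ \frac{\hat\kappa}{2}\|x-\bar x\|_1^2\quad\forall x\in\hat X,\qquad\text{with }\hat\kappa=\frac{\kappa}{qL_{\max}R^{2-q}}.$$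
   Context: $\|\cdot\|$ is the Euclidean norm; $\bar x=[x]_{X^*}$ is the projection of $x$ onto $X^*$. Setting: $Q\subset\mathbb{R}^m$ is a closed convex bounded set, $A\in\mathbb{R}^{m\times n}$, $\phi$ is a continuous convex function on $Q$, and $f:\mathbb{R}^n\to\mathbb{R}$ is convex with block coordinate-wise Lipschitz gradient. Nesterov's smoothing of $F$ is $F_\gamma(x)=f(x)+\max_{u\in Q}\{\langle Ax,u\rangle-\phi(u)-\gamma d(u)\}$, where $d$ is strongly convex on $Q$ (with respect to some norm) and $d(u)\ge0$ for all $u\in Q$. $\bar D=\max_{u\in Q}d(u)$, $F_\gamma^*=\min_xF_\gamma(x)$, $\mathcal{L}_{F_\gamma}(x_0)=\{x: F_\gamma(x)\le F_\gamma(x_0)\}$. Blocks: $U=[U_1,\dots,U_N]$ is a column permutation of the $n\times n$ identity matrix, $U_i\in\mathbb{R}^{n\times n_i}$, $\sum_in_i=n$, $x^{(i)}=U_i^Tx$. On each $\mathbb{R}^{n_i}$ some norm $\|\cdot\|_{(i)}$ is fixed. $L_i(F_\gamma)>0$ are block coordinate-wise Lipschitz constants of $\nabla F_\gamma$: $\|U_i^T(\nabla F_\gamma(x+U_ih)-\nabla F_\gamma(x))\|_{(i)}\le L_i(F_\gamma)\|h\|_{(i)}$ for all $x\in\mathbb{R}^n$, $h\in\mathbb{R}^{n_i}$, $i=1,\dots,N$ (block coordinate-wise Lipschitz continuity of $\nabla f$ is meant in the same sense). $L_{\max}=\max_iL_i(F_\gamma)$ and $\|x\|_1^2=\sum_{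i=1}^NL_i(F_\gamma)\|x^{(i)}\|_{(i)}^2$.
   Formalization: Each block norm is additionally assumed to be at most the Euclidean norm of the block; for arbitrary block norms the claim fails (e.g. F(x)=|x|, d(u)=u²/2, block norm c|h| with c>1). *)

theory Defs
  imports "HOL-Analysis.Analysis"
begin

definition is_norm :: "('a::real_vector \<Rightarrow> real) \<Rightarrow> bool" where
  "is_norm \<nu> \<longleftrightarrow>
     (\<forall>x. 0 \<le> \<nu> x) \<and> (\<forall>x. \<nu> x = 0 \<longleftrightarrow> x = 0) \<and>
     (\<forall>c x. \<nu> (c *\<^sub>R x) = \<bar>c\<bar> * \<nu> x) \<and> (\<forall>x y. \<nu> (x + y) \<le> \<nu> x + \<nu> y)"

definition strongly_convex_on :: "('a::real_vector) set \<Rightarrow> ('a \<Rightarrow> real) \<Rightarrow> bool" where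
  "strongly_convex_on Q d \<longleftrightarrow>
     convex Q \<and>
     (\<exists>\<nu> \<sigma>. is_norm \<nu> \<and> \<sigma> > 0 \<and>
       (\<forall>u\<in>Q. \<forall>v\<in>Q. \<forall>t\<in>{0..1}.
          d (t *\<^sub>R u + (1 - t) *\<^sub>R v)
            \<le> t * d u + (1 - t) * d v - \<sigma> / 2 * t * (1 - t) * (\<nu> (u - v))\<^sup>2))"

text \<open>
  The inner maxima are written as suprema. For \<open>F\<close> and \<open>F\<^sub>\<gamma>\<close> as used below they are suprema of
  nonempty sets that are bounded above (\<open>Q\<close> compact, \<open>\<phi>\<close> continuous, \<open>d \<ge> 0\<close>), so they agree
  with the maxima whenever these are attained.
\<close>

definition composite_obj ::
  "(real^'n \<Rightarrow> real) \<Rightarrow> real^'n^'m \<Rightarrow> (real^'m) set \<Rightarrow> (real^'m \<Rightarrow> real) \<Rightarrow> real^'n \<Rightarrow> real" where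
  "composite_obj f A Q \<phi> x = f x + (SUP u\<in>Q. (A *v x) \<bullet> u - \<phi> u)"

definition nesterov_smoothing ::
  "(real^'n \<Rightarrow> real) \<Rightarrow> real^'n^'m \<Rightarrow> (real^'m) set \<Rightarrow> (real^'m \<Rightarrow> real) \<Rightarrow>
   (real^'m \<Rightarrow> real) \<Rightarrow> real \<Rightarrow> real^'n \<Rightarrow> real" where
  "nesterov_smoothing f A Q \<phi> d \<gamma> x = f x + (SUP u\<in>Q. (A *v x) \<bullet> u - \<phi> u - \<gamma> * d u)"

definition minimizers :: "('a \<Rightarrow> real) \<Rightarrow> 'a set" where
  "minimizers F = {x. \<forall>y. F x \<le> F y}"

text \<open>
  \<open>\<real>\<^sup>m\<close> with \<open>m\<close> a natural number is the set of real sequences supported on \<open>{..<m}\<close>, the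
  convention of \<^const>\<open>Euclidean_space\<close>.
\<close>

definition coord_space :: "nat \<Rightarrow> (nat \<Rightarrow> real) set" where
  "coord_space m = {h. \<forall>k\<ge>m. h k = 0}"

definition is_coord_norm :: "nat \<Rightarrow> ((nat \<Rightarrow> real) \<Rightarrow> real) \<Rightarrow> bool" where
  "is_coord_norm m \<nu> \<longleftrightarrow>
     (\<forall>h\<in>coord_space m. 0 \<le> \<nu> h) \<and>
     (\<forall>h\<in>coord_space m. \<nu> h = 0 \<longleftrightarrow> (\<forall>k. h k = 0)) \<and>
     (\<forall>c. \<forall>h\<in>coord_space m. \<nu> (\<lambda>k. c * h k) = \<bar>c\<bar> * \<nu> h) \<and>
     (\<forall>g\<in>coord_space m. \<forall>h\<in>coord_space m. \<nu> (\<lambda>k. g k + h k) \<le> \<nu> g + \<nu> h)"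

text \<open>
  The block matrix \<open>U = [U\<^sub>1, \<dots>, U\<^sub>N]\<close> is a column permutation of the identity, so it is given by
  the map \<open>p\<close> for which column \<open>k\<close> of \<open>U\<^sub>i\<close> is the unit vector with index \<open>p i k\<close>; blocks and
  columns are numbered from \<open>0\<close>, and \<open>ns i\<close> is the number of columns of \<open>U\<^sub>i\<close>.
  Then \<open>block_embed p ns i h\<close> is \<open>U\<^sub>i h\<close> and \<open>block_part p ns i x\<close> is \<open>U\<^sub>i\<^sup>T x\<close>.
\<close>

definition block_structure :: "nat \<Rightarrow> (nat \<Rightarrow> nat) \<Rightarrow> (nat \<Rightarrow> nat \<Rightarrow> 'n) \<Rightarrow> bool" where
  "block_structure N ns p \<longleftrightarrow>
     bij_betw (\<lambda>(i, k). p i k) (SIGMA i:{..<N}. {..<ns i}) UNIV"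

definition block_embed ::
  "(nat \<Rightarrow> nat \<Rightarrow> 'n) \<Rightarrow> (nat \<Rightarrow> nat) \<Rightarrow> nat \<Rightarrow> (nat \<Rightarrow> real) \<Rightarrow> real^'n" where
  "block_embed p ns i h = (\<Sum>k<ns i. h k *\<^sub>R axis (p i k) 1)"

definition block_part ::
  "(nat \<Rightarrow> nat \<Rightarrow> 'n) \<Rightarrow> (nat \<Rightarrow> nat) \<Rightarrow> nat \<Rightarrow> real^'n \<Rightarrow> nat \<Rightarrow> real" where
  "block_part p ns i x = (\<lambda>k. if k < ns i then x $ p i k else 0)"

definition block_lipschitz_gradient ::
  "nat \<Rightarrow> (nat \<Rightarrow> nat) \<Rightarrow> (nat \<Rightarrow> nat \<Rightarrow> 'n::finite) \<Rightarrow> (nat \<Rightarrow> (nat \<Rightarrow> real) \<Rightarrow> real) \<Rightarrow>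
   (nat \<Rightarrow> real) \<Rightarrow> (real^'n \<Rightarrow> real) \<Rightarrow> bool" where
  "block_lipschitz_gradient N ns p \<nu> L g \<longleftrightarrow>
     (\<forall>i<N. 0 < L i) \<and>
     (\<exists>G. (\<forall>x. GDERIV g x :> G x) \<and>
       (\<forall>i<N. \<forall>x. \<forall>h\<in>coord_space (ns i).
          \<nu> i (block_part p ns i (G (x + block_embed p ns i h) - G x)) \<le> L i * \<nu> i h))"

definition weighted_norm ::
  "nat \<Rightarrow> (nat \<Rightarrow> nat) \<Rightarrow> (nat \<Rightarrow> nat \<Rightarrow> 'n) \<Rightarrow> (nat \<Rightarrow> (nat \<Rightarrow> real) \<Rightarrow> real) \<Rightarrow>
   (nat \<Rightarrow> real) \<Rightarrow> real^'n \<Rightarrow> real" where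
  "weighted_norm N ns p \<nu> L x = sqrt (\<Sum>i<N. L i * (\<nu> i (block_part p ns i x))\<^sup>2)"

end

theory Submission
  imports Defs
begin

text \<open>
  The smoothing term \<open>\<gamma> * d u\<close> lies between \<open>0\<close> and \<open>\<gamma> * Dbar\<close> on \<open>Q\<close>, so the smoothed objective
  lies below \<open>F\<close>, by at most \<open>\<gamma> * Dbar\<close> (\<open>smoothing_le_composite\<close>, \<open>composite_le_smoothing\<close>).
  This has two effects. A sublevel set of \<open>F\<gamma>\<close> is contained in the sublevel set of \<open>F\<close> with the
  level raised by \<open>\<gamma> * Dbar\<close>, which is exactly where the growth of \<open>F\<close> is assumed; and since
  \<open>F\<gamma>star \<le> Fstar\<close>, every growth bound for \<open>F x - Fstar\<close> passes to \<open>F\<gamma> x - F\<gamma>star\<close>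
  at the price of \<open>\<gamma> * Dbar\<close>. This is the first claim with the Euclidean norm.

  On \<open>X_hat\<close> the price is at most \<open>F\<gamma> x - Fstar\<close>, so moving it to the other side only halves the
  constant. That is the second claim. When the distances are at most \<open>R\<close>, the power \<open>q \<le> 2\<close> of a
  distance dominates its square divided by \<open>R powr (2 - q)\<close>, and the third claim follows from the
  Euclidean form of the second.

  The weighted norm enters at the end only. The block norms are dominated by the Euclidean norms of
  the blocks, whose squares add up to the square of the full norm, so the weighted norm is at most
  \<open>sqrt Lmax\<close> times the Euclidean norm (\<open>weighted_norm_le\<close>).
\<close>

lemma sum_L2_set_blocks:
  fixes x :: "real^'n"
  assumes "block_structure N ns p"
  shows "(\<Sum>i<N. (L2_set (block_part p ns i x) {..<ns i})\<^sup>2) = (norm x)\<^sup>2"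
proof -
  have "(\<Sum>i<N. (L2_set (block_part p ns i x) {..<ns i})\<^sup>2) = (\<Sum>i<N. \<Sum>k<ns i. (x $ p i k)\<^sup>2)"
    by (simp add: L2_set_def sum_nonneg block_part_def)
  also have "\<dots> = (\<Sum>(i, k)\<in>(SIGMA i:{..<N}. {..<ns i}). (x $ p i k)\<^sup>2)"
    by (simp add: sum.Sigma)
  also have "\<dots> = (\<Sum>z\<in>(SIGMA i:{..<N}. {..<ns i}). (x $ (case z of (i, k) \<Rightarrow> p i k))\<^sup>2)"
    by (rule sum.cong) auto
  also have "\<dots> = (\<Sum>j\<in>UNIV. (x $ j)\<^sup>2)"
    using assms unfolding block_structure_def by (rule sum.reindex_bij_betw)
  also have "\<dots> = (norm x)\<^sup>2"
    by (simp add: norm_vec_def L2_set_def sum_nonneg)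
  finally show ?thesis .
qed

lemma block_structure_nonempty:
  assumes "block_structure N ns (p :: nat \<Rightarrow> nat \<Rightarrow> 'n)"
  shows "0 < N"
proof (rule ccontr)
  assume "\<not> 0 < N"
  then have "(UNIV :: 'n set) = {}"
    using assms by (simp add: block_structure_def bij_betw_def)
  then show False by simp
qed

lemma weighted_norm_le:
  fixes x :: "real^'n"
  assumes blocks: "block_structure N ns p"
    and norms: "\<And>i. i < N \<Longrightarrow> is_coord_norm (ns i) (\<nu> i)"
    and le: "\<And>i h. i < N \<Longrightarrow> h \<in> coord_space (ns i) \<Longrightarrow> \<nu> i h \<le> L2_set h {..<ns i}"
    and pos: "\<And>i. i < N \<Longrightarrow> 0 \<le> L i"
    and M: "\<And>i. i < N \<Longrightarrow> L i \<le> M"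
  shows "weighted_norm N ns p \<nu> L x \<le> sqrt M * norm x"
proof -
  have "L i * (\<nu> i (block_part p ns i x))\<^sup>2 \<le> M * (L2_set (block_part p ns i x) {..<ns i})\<^sup>2"
    if i: "i < N" for i
  proof -
    have h: "block_part p ns i x \<in> coord_space (ns i)"
      by (simp add: block_part_def coord_space_def)
    have "0 \<le> \<nu> i (block_part p ns i x)"
      using norms[OF i] h by (simp add: is_coord_norm_def)
    then have "(\<nu> i (block_part p ns i x))\<^sup>2 \<le> (L2_set (block_part p ns i x) {..<ns i})\<^sup>2"
      using le[OF i h] by (rule power_mono[rotated])
    then show ?thesis
      using pos[OF i] M[OF i] by (intro mult_mono) auto
  qed
  then have "(\<Sum>i<N. L i * (\<nu> i (block_part p ns i x))\<^sup>2)
      \<le> (\<Sum>i<N. M * (L2_set (block_part p ns i x) {..<ns i})\<^sup>2)"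
    by (intro sum_mono) auto
  also have "\<dots> = M * (norm x)\<^sup>2"
    by (simp only: sum_distrib_left[symmetric] sum_L2_set_blocks[OF blocks])
  finally have "weighted_norm N ns p \<nu> L x \<le> sqrt (M * (norm x)\<^sup>2)"
    by (simp add: weighted_norm_def)
  then show ?thesis
    by (simp add: real_sqrt_mult)
qed

text \<open>
  The supremum in \<^const>\<open>composite_obj\<close> is a least upper bound only if its set is bounded above.
  The same bound serves \<^const>\<open>nesterov_smoothing\<close>, where a nonnegative term is subtracted.
\<close>

lemma bdd_above_inner_diff:
  fixes \<phi> :: "real^'m \<Rightarrow> real"
  assumes "compact Q" "continuous_on Q \<phi>"
  shows "bdd_above ((\<lambda>u. y \<bullet> u - \<phi> u) ` Q)"
proof -
  have "continuous_on Q (\<lambda>u. y \<bullet> u - \<phi> u)"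
    using assms by (intro continuous_intros)
  then show ?thesis
    using assms by (intro bounded_imp_bdd_above compact_imp_bounded compact_continuous_image)
qed

lemma smoothing_le_composite:
  fixes A :: "real^'n^'m"
  assumes Q: "compact Q" "Q \<noteq> {}" and phi: "continuous_on Q \<phi>"
    and d: "\<And>u. u \<in> Q \<Longrightarrow> 0 \<le> d u" and gamma: "0 \<le> \<gamma>"
  shows "nesterov_smoothing f A Q \<phi> d \<gamma> x \<le> composite_obj f A Q \<phi> x"
proof -
  have "(SUP u\<in>Q. (A *v x) \<bullet> u - \<phi> u - \<gamma> * d u) \<le> (SUP u\<in>Q. (A *v x) \<bullet> u - \<phi> u)"
    using Q(2) bdd_above_inner_diff[OF Q(1) phi]
  proof (rule cSUP_mono)
    fix u assume u: "u \<in> Q"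
    then have "0 \<le> \<gamma> * d u" using d gamma by simp
    with u show "\<exists>v\<in>Q. (A *v x) \<bullet> u - \<phi> u - \<gamma> * d u \<le> (A *v x) \<bullet> v - \<phi> v"
      by (intro bexI[of _ u]) auto
  qed
  then show ?thesis
    by (simp add: nesterov_smoothing_def composite_obj_def)
qed

lemma composite_le_smoothing:
  fixes A :: "real^'n^'m"
  assumes Q: "compact Q" "Q \<noteq> {}" and phi: "continuous_on Q \<phi>"
    and d: "\<And>u. u \<in> Q \<Longrightarrow> 0 \<le> d u" "bdd_above (d ` Q)" and gamma: "0 \<le> \<gamma>"
  shows "composite_obj f A Q \<phi> x \<le> nesterov_smoothing f A Q \<phi> d \<gamma> x + \<gamma> * (SUP u\<in>Q. d u)"
proof -
  let ?g = "\<lambda>u. (A *v x) \<bullet> u - \<phi> u"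
  obtain B where B: "\<And>u. u \<in> Q \<Longrightarrow> ?g u \<le> B"
    using bdd_above_inner_diff[OF Q(1) phi, of "A *v x"] by (auto simp: bdd_above_def)
  have bdd: "bdd_above ((\<lambda>u. ?g u - \<gamma> * d u) ` Q)"
  proof (rule bdd_aboveI2)
    fix u assume u: "u \<in> Q"
    show "?g u - \<gamma> * d u \<le> B"
      using B[OF u] mult_nonneg_nonneg[OF gamma d(1)[OF u]] by linarith
  qed
  have "(SUP u\<in>Q. ?g u) \<le> (SUP u\<in>Q. ?g u - \<gamma> * d u) + \<gamma> * (SUP u\<in>Q. d u)"
  proof (rule cSUP_least[OF Q(2)])
    fix u assume u: "u \<in> Q"
    have "\<gamma> * d u \<le> \<gamma> * (SUP u\<in>Q. d u)"
      using cSUP_upper[OF u d(2)] gamma by (rule mult_left_mono)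
    with cSUP_upper[OF u bdd]
    show "?g u \<le> (SUP u\<in>Q. ?g u - \<gamma> * d u) + \<gamma> * (SUP u\<in>Q. d u)" by linarith
  qed
  then show ?thesis
    by (simp add: nesterov_smoothing_def composite_obj_def)
qed

text \<open>
  Splitting \<open>r\<^sup>2\<close> as \<open>r powr q * r powr (2 - q)\<close> and bounding the second factor by
  \<open>R powr (2 - q)\<close> trades a power below two for a quadratic.
\<close>

lemma square_div_powr_le_powr:
  fixes r R q :: real
  assumes "0 \<le> r" "r \<le> R" "0 < R" "q \<le> 2"
  shows "r\<^sup>2 / R powr (2 - q) \<le> r powr q"
proof (cases "r = 0")
  case False
  then have r: "0 < r" using assms by simp
  have "r\<^sup>2 = r powr q * r powr (2 - q)"
    using r by (simp flip: powr_add)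
  also have "\<dots> \<le> r powr q * R powr (2 - q)"
    using assms by (intro mult_left_mono powr_mono2) auto
  finally show ?thesis
    using assms by (simp add: divide_le_eq)
qed simp

theorem theorem2:
  fixes f F F\<gamma> :: "real^'n \<Rightarrow> real"
    and A :: "real^'n^'m"
    and Q :: "(real^'m) set"
    and \<phi> d :: "real^'m \<Rightarrow> real"
    and \<gamma> Dbar Fstar F\<gamma>star Lmax \<kappa> q :: real
    and N :: nat
    and ns :: "nat \<Rightarrow> nat"
    and p :: "nat \<Rightarrow> nat \<Rightarrow> 'n"
    and \<nu> :: "nat \<Rightarrow> (nat \<Rightarrow> real) \<Rightarrow> real"
    and L :: "nat \<Rightarrow> real"
    and norm1 :: "real^'n \<Rightarrow> real"
    and X lev X_hat :: "(real^'n) set"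
    and bar :: "real^'n \<Rightarrow> real^'n"
    and x0 :: "real^'n"
  assumes Q: "closed Q" "convex Q" "bounded Q" "Q \<noteq> {}"
    and phi: "continuous_on Q \<phi>" "convex_on Q \<phi>"
    and d: "strongly_convex_on Q d" "\<forall>u\<in>Q. 0 \<le> d u" "\<exists>u\<in>Q. \<forall>v\<in>Q. d v \<le> d u"
    and blocks: "block_structure N ns p"
    and norms: "\<forall>i<N. is_coord_norm (ns i) (\<nu> i)"
    and norms_le: "\<forall>i<N. \<forall>h\<in>coord_space (ns i). \<nu> i h \<le> L2_set h {..<ns i}"
    and f: "convex_on UNIV f" "\<exists>Lf. block_lipschitz_gradient N ns p \<nu> Lf f"
    and gamma: "\<gamma> > 0"
    and F: "F = composite_obj f A Q \<phi>"
    and F\<gamma>: "F\<gamma> = nesterov_smoothing f A Q \<phi> d \<gamma>"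
    and L: "block_lipschitz_gradient N ns p \<nu> L F\<gamma>"
    and Dbar: "Dbar = (SUP u\<in>Q. d u)"
    and Fstar: "Fstar = (INF x. F x)"
    and F\<gamma>star: "F\<gamma>star = (INF x. F\<gamma> x)"
    and Lmax: "Lmax = Max (L ` {..<N})"
    and norm1: "norm1 = weighted_norm N ns p \<nu> L"
    and X: "X = minimizers F" "X \<noteq> {}"
    and bar: "bar = closest_point X"
    and lev: "lev = {x. F\<gamma> x \<le> F\<gamma> x0}"
    and X_hat: "X_hat = lev \<inter> {x. F\<gamma> x - Fstar \<ge> \<gamma> * Dbar}"
    and kappa: "\<kappa> > 0" and q: "1 \<le> q" "q \<le> 2"
    and growth: "\<forall>x. F x \<le> F x0 + \<gamma> * Dbar \<longrightarrow> F x - Fstar \<ge> \<kappa> / q * norm (x - bar x) powr q"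
  shows "(\<forall>x\<in>lev. F\<gamma> x - F\<gamma>star
            \<ge> \<kappa> / (q * Lmax powr (q / 2)) * norm1 (x - bar x) powr q - \<gamma> * Dbar) \<and>
         (\<forall>x\<in>X_hat. F\<gamma> x - F\<gamma>star
            \<ge> \<kappa> / (2 * q * Lmax powr (q / 2)) * norm1 (x - bar x) powr q) \<and>
         (\<forall>R>0. (\<forall>x\<in>lev. norm (x - bar x) \<le> R) \<longrightarrow>
            (\<forall>x\<in>X_hat. F\<gamma> x - F\<gamma>star
               \<ge> (\<kappa> / (q * Lmax * R powr (2 - q))) / 2 * (norm1 (x - bar x))\<^sup>2))"
proof -
  have cQ: "compact Q" using Q by (simp add: compact_eq_bounded_closed)
  have bdd_d: "bdd_above (d ` Q)" using d(3) by (auto simp: bdd_above_def)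
  have F\<gamma>_le: "F\<gamma> x \<le> F x" for x
    unfolding F F\<gamma> using Q phi d gamma cQ by (intro smoothing_le_composite) auto
  have F_le: "F x \<le> F\<gamma> x + \<gamma> * Dbar" for x
    unfolding F F\<gamma> Dbar using Q phi d gamma cQ bdd_d by (intro composite_le_smoothing) auto
  have stars: "F\<gamma>star \<le> Fstar"
  proof -
    obtain z where "\<And>y. F z \<le> F y" using X by (auto simp: minimizers_def)
    then have "F z - \<gamma> * Dbar \<le> F\<gamma> y" for y using F_le[of y] by (smt (verit))
    then have "bdd_below (range F\<gamma>)" by (intro bdd_belowI2)
    then show ?thesis
      unfolding Fstar F\<gamma>star using F\<gamma>_le by (intro cINF_mono) auto
  qed

  \<comment> \<open>The sublevel set of \<open>F\<gamma>\<close> lies where the growth of \<open>F\<close> is assumed.\<close>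
  have growth_lev: "\<kappa> / q * norm (x - bar x) powr q \<le> F\<gamma> x - Fstar + \<gamma> * Dbar" if "x \<in> lev" for x
  proof -
    have "F x \<le> F x0 + \<gamma> * Dbar"
      using that F_le[of x] F\<gamma>_le[of x0] by (simp add: lev)
    then show ?thesis using growth F_le[of x] by (smt (verit))
  qed
  have growth_hat: "\<kappa> / q * norm (x - bar x) powr q / 2 \<le> F\<gamma> x - F\<gamma>star" if "x \<in> X_hat" for x
  proof -
    define t where "t = \<kappa> / q * norm (x - bar x) powr q"
    have "x \<in> lev" "\<gamma> * Dbar \<le> F\<gamma> x - Fstar"
      using that by (auto simp: X_hat)
    with growth_lev[OF this(1), folded t_def] stars have "t / 2 \<le> F\<gamma> x - F\<gamma>star"
      by linarith
    then show ?thesis by (simp only: t_def)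
  qed

  have Lpos: "0 < L i" if "i < N" for i
    using L that by (auto simp: block_lipschitz_gradient_def)
  have Lle: "L i \<le> Lmax" if "i < N" for i
    unfolding Lmax using that by (intro Max_ge) auto
  have Lmax_pos: "0 < Lmax"
    using Lpos Lle block_structure_nonempty[OF blocks] by fastforce
  have norm1_le: "norm1 z \<le> sqrt Lmax * norm z" for z
    unfolding norm1 using norms norms_le Lpos Lle
    by (intro weighted_norm_le[OF blocks]) (auto intro: less_imp_le)
  have norm1_nonneg: "0 \<le> norm1 z" for z
    unfolding norm1 weighted_norm_def using Lpos
    by (intro real_sqrt_ge_zero sum_nonneg) (simp add: less_imp_le)
  have norm1_powr: "norm1 z powr q / Lmax powr (q / 2) \<le> norm z powr q" for z
  proof -
    have "norm1 z powr q \<le> (sqrt Lmax * norm z) powr q"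
      using norm1_le norm1_nonneg q by (intro powr_mono2) auto
    also have "\<dots> = Lmax powr (q / 2) * norm z powr q"
      using Lmax_pos by (simp add: powr_mult powr_powr flip: powr_half_sqrt)
    finally show ?thesis using Lmax_pos by (simp add: divide_le_eq mult.commute)
  qed
  have norm1_square: "(norm1 z)\<^sup>2 / Lmax \<le> (norm z)\<^sup>2" for z
  proof -
    have "(norm1 z)\<^sup>2 \<le> (sqrt Lmax * norm z)\<^sup>2"
      using norm1_le norm1_nonneg by (rule power_mono)
    then show ?thesis using Lmax_pos by (simp add: power_mult_distrib divide_le_eq mult.commute)
  qed
  have scaled: "\<kappa> / q * (norm1 z powr q / Lmax powr (q / 2)) \<le> \<kappa> / q * norm z powr q" for z
    using norm1_powr kappa q by (intro mult_left_mono) auto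

  have 1: "\<kappa> / (q * Lmax powr (q / 2)) * norm1 (x - bar x) powr q - \<gamma> * Dbar \<le> F\<gamma> x - F\<gamma>star"
    if "x \<in> lev" for x
    using scaled[of "x - bar x"] growth_lev[OF that] stars by simp
  have 2: "\<kappa> / (2 * q * Lmax powr (q / 2)) * norm1 (x - bar x) powr q \<le> F\<gamma> x - F\<gamma>star"
    if "x \<in> X_hat" for x
    using order_trans[OF divide_right_mono[OF scaled] growth_hat[OF that]]
    by (simp add: mult_ac)
  have 3: "(\<kappa> / (q * Lmax * R powr (2 - q))) / 2 * (norm1 (x - bar x))\<^sup>2 \<le> F\<gamma> x - F\<gamma>star"
    if R: "0 < R" "\<forall>x\<in>lev. norm (x - bar x) \<le> R" and x: "x \<in> X_hat" for R x
  proof -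
    have "norm (x - bar x) \<le> R" using R x by (auto simp: X_hat)
    then have "(norm (x - bar x))\<^sup>2 / R powr (2 - q) \<le> norm (x - bar x) powr q"
      using R q by (intro square_div_powr_le_powr) auto
    moreover have "(norm1 (x - bar x))\<^sup>2 / Lmax / R powr (2 - q)
        \<le> (norm (x - bar x))\<^sup>2 / R powr (2 - q)"
      using norm1_square by (intro divide_right_mono) auto
    ultimately have "\<kappa> / q * ((norm1 (x - bar x))\<^sup>2 / Lmax / R powr (2 - q))
        \<le> \<kappa> / q * norm (x - bar x) powr q"
      using kappa q by (intro mult_left_mono) auto
    from order_trans[OF divide_right_mono[OF this] growth_hat[OF x]]
    show ?thesis by (simp add: mult_ac)
  qed
  show ?thesis using 1 2 3 by blast
qed

end
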